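(* Let $\mathbf{K}$ be a field, let $m>n\geq 1$ be integers, and let $f_1,\ldots,f_m\in\mathbf{K}[X_1,\ldots,X_n]$ be homogeneous polynomials of degree $2$ such that $\mathbf{K}[X_1,\ldots,X_n]/(f_1,\ldots,f_m)$ is finite-dimensional over $\mathbf{K}$ and $f_1,\ldots,f_m$ is a semi-regular sequence. Consider the sextic polynomial $$s(x)=x(x-1)^2(2m-n-x^3)-\tfrac14n^2.$$ Then the maximum of $s$ over $(1,\infty)$ is attained at some $x'\in(1,(2m-n)^{1/3})$. If $s(x')\geq0$, then $s$ has a unique real root $x_5\in(1,x']$. If moreover $x_5^3\leq\lfloor(2m-n)/2\rfloor$, then $$d_{reg}\leq 1+\left\lceil x_5^3\right\rceil.$$
   Context: For a graded algebra or homogeneous ideal, a subscript $d$ denotes the degree-$d$ homogeneous component. Let $J=(f_1,\ldots,f_m)$. The degree of regularity is $d_{reg}=\min\{d\geq 0: \dim_{\mathbf{K}} J_d=\dim_{\mathbf{K}}\mathbf{K}[X_1,\ldots,X_n]_d\}$. The sequence $f_1,\ldots,f_m$ is semi-regular if for each $i=1,\ldots,m$ and each $j<d_{reg}-2$ the multiplication map $S(i-1)_j\to S(i-1)_{j+2}$, $g\mapsto gf_i$, is injective, where $S(i-1)=\mathbf{K}[X_1,\ldots,X_n]/(f_1,\ldots,f_{i-1})$. *)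

theory Defs
  imports Complex_Main "HOL-Library.Poly_Mapping" "HOL-Library.Cardinality"
begin

text \<open>
  The polynomial ring \<open>K[X_1, ..., X_n]\<close>, with \<open>n = CARD('n)\<close>: an exponent vector is an element of
  \<open>'n \<Rightarrow>\<^sub>0 nat\<close>, and a polynomial maps exponent vectors to coefficients with finite support.
  The ring multiplication is the convolution product of \<open>HOL-Library.Poly_Mapping\<close>.
\<close>

type_synonym ('n, 'k) mpoly = "('n \<Rightarrow>\<^sub>0 nat) \<Rightarrow>\<^sub>0 'k"

definition scale :: "'k::field \<Rightarrow> ('n, 'k) mpoly \<Rightarrow> ('n, 'k) mpoly" where
  "scale c p = Poly_Mapping.single 0 c * p"

lemma vector_space_scale: "vector_space (scale :: 'k::field \<Rightarrow> ('n, 'k) mpoly \<Rightarrow> _)"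
  by unfold_locales
    (simp_all add: scale_def distrib_left distrib_right single_add mult_single
       flip: mult.assoc)

definition total_degree :: "('n::finite \<Rightarrow>\<^sub>0 nat) \<Rightarrow> nat" where
  "total_degree t = (\<Sum>x\<in>UNIV. Poly_Mapping.lookup t x)"

text \<open>The zero polynomial belongs to every \<open>homog_part d\<close>.\<close>

definition homog_part :: "nat \<Rightarrow> ('n::finite, 'k::field) mpoly set" where
  "homog_part d = {p. \<forall>t\<in>Poly_Mapping.keys p. total_degree t = d}"

text \<open>The ideal generated by \<open>F\<close> is the submodule generated by \<open>F\<close> of the ring over itself.\<close>

definition ideal :: "('n, 'k::field) mpoly set \<Rightarrow> ('n, 'k) mpoly set" where
  "ideal F = module.span (*) F"

lemma module_times: "module ((*) :: 'a::comm_ring_1 \<Rightarrow> 'a \<Rightarrow> 'a)"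
  by unfold_locales (simp_all add: algebra_simps)

definition coset :: "('n, 'k::field) mpoly set \<Rightarrow> ('n, 'k) mpoly \<Rightarrow> ('n, 'k) mpoly set" where
  "coset I p = (\<lambda>h. p + h) ` I"

text \<open>
  The quotient of the polynomial ring by \<open>I\<close> is finite-dimensional over the field of coefficients:
  finitely many cosets \<open>coset I b\<close>, \<open>b \<in> B\<close>, span it, i.e. every coset is the coset of a
  linear combination of elements of \<open>B\<close>.
\<close>

definition finite_dim_quotient :: "('n, 'k::field) mpoly set \<Rightarrow> bool" where
  "finite_dim_quotient I \<longleftrightarrow>
     (\<exists>B. finite B \<and> coset I ` UNIV = coset I ` module.span scale B)"

definition quot_part :: "('n::finite, 'k::field) mpoly set \<Rightarrow> nat \<Rightarrow> ('n, 'k) mpoly set set" where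
  "quot_part I d = coset I ` homog_part d"

text \<open>
  Multiplication by \<open>f\<close> on the quotient by \<open>I\<close>, sending \<open>coset I g\<close> to \<open>coset I (g * f)\<close>
  (see \<open>quot_mult_coset\<close>). As for \<open>rcoset_mult\<close> in \<open>HOL-Algebra\<close>, the union over all
  representatives avoids choosing one.
\<close>

definition quot_mult ::
  "('n, 'k::field) mpoly set \<Rightarrow> ('n, 'k) mpoly \<Rightarrow> ('n, 'k) mpoly set \<Rightarrow> ('n, 'k) mpoly set" where
  "quot_mult I f C = (\<Union>g\<in>C. coset I (g * f))"

lemma quot_mult_coset: "quot_mult (ideal F) f (coset (ideal F) g) = coset (ideal F) (g * f)"
proof -
  interpret module "(*) :: ('n, 'k::field) mpoly \<Rightarrow> _" by (rule module_times)
  have "(g + h) * f + k \<in> coset (ideal F) (g * f)" if "h \<in> ideal F" "k \<in> ideal F" for h k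
  proof -
    have "f * h + k \<in> ideal F"
      using that unfolding ideal_def by (intro span_add span_scale)
    moreover have "(g + h) * f + k = g * f + (f * h + k)" by (simp add: algebra_simps)
    ultimately show ?thesis unfolding coset_def by blast
  qed
  moreover have "0 \<in> ideal F" unfolding ideal_def by (rule span_zero)
  then have "coset (ideal F) (g * f) \<subseteq> quot_mult (ideal F) f (coset (ideal F) g)"
    unfolding quot_mult_def coset_def by force
  ultimately show ?thesis unfolding quot_mult_def by (auto simp: coset_def)
qed

definition degree_of_regularity :: "('n::finite, 'k::field) mpoly set \<Rightarrow> nat" where
  "degree_of_regularity J =
     (LEAST d. vector_space.dim scale (J \<inter> homog_part d)
             = vector_space.dim scale (homog_part d :: ('n, 'k) mpoly set))"

text \<open>
  The sequence is \<open>f 1, ..., f m\<close>. The bound \<open>j < d_reg - 2\<close> is over the integers, hence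
  written without truncating subtraction.
\<close>

definition semi_regular :: "nat \<Rightarrow> (nat \<Rightarrow> ('n::finite, 'k::field) mpoly) \<Rightarrow> bool" where
  "semi_regular m f \<longleftrightarrow>
     (\<forall>i\<in>{1..m}. \<forall>j. j + 2 < degree_of_regularity (ideal (f ` {1..m})) \<longrightarrow>
        inj_on (quot_mult (ideal (f ` {1..<i})) (f i)) (quot_part (ideal (f ` {1..<i})) j))"

definition sextic :: "nat \<Rightarrow> nat \<Rightarrow> real \<Rightarrow> real" where
  "sextic m n x = x * (x - 1)\<^sup>2 * (2 * real m - real n - x ^ 3) - 1 / 4 * (real n)\<^sup>2"

end

theory Submission
  imports Defs "HOL-Library.Multiset"
begin

text \<open>
  Below the degree of regularity, semi-regularity makes the Hilbert function of the quotient by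
  \<open>f\<^sub>1, ..., f\<^sub>m\<close> equal to the coefficients \<open>h\<^sub>k\<close> of \<open>(1 - z\<^sup>2)\<^sup>m / (1 - z)\<^sup>n = (1 - z)\<^bsup>m - n\<^esup> (1 + z)\<^sup>m\<close>,
  which are therefore positive there. These are values of Krawtchouk polynomials and, with
  \<open>N = 2 m - n\<close>, satisfy \<open>(k + 1) h\<^bsub>k + 1\<^esub> = n h\<^sub>k - (N - k + 1) h\<^bsub>k - 1\<^esub>\<close>. If \<open>h\<^sub>0, ..., h\<^bsub>M + 1\<^esub>\<close> are all
  positive, dividing by \<open>h\<^sub>k\<close>, summing over \<open>k\<close> in a window ending at \<open>M\<close> and applying the inequality of
  arithmetic and geometric means to the neighbouring ratios bounds \<open>n\<close> from below. With
  \<open>M = \<lceil>x\<^sub>5\<^sup>3\<rceil>\<close> and a window of \<open>\<lceil>x\<^sub>5\<rceil> + 1\<close> indices this contradicts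
  \<open>n = 2 (x\<^sub>5 - 1) sqrt (x\<^sub>5 (N - x\<^sub>5\<^sup>3))\<close>, which is the equation \<open>s(x\<^sub>5) = 0\<close>.
\<close>

section \<open>The Hilbert function of a semi-regular sequence\<close>

text \<open>Rank-nullity for the map that \<open>\<phi>\<close> induces from \<open>V\<close> to the
  quotient by \<open>A\<close>: its kernel is \<open>W\<close>. The additive form avoids truncated
  subtraction.\<close>

lemma (in vector_space) dim_add_image:
  assumes lin: "Vector_Spaces.linear scale scale \<phi>"
    and sub: "subspace A" "subspace W" "subspace V"
    and WV: "W \<subseteq> V" "V \<subseteq> span G" "finite G"
    and preimage: "\<And>v. v \<in> V \<Longrightarrow> \<phi> v \<in> A \<Longrightarrow> v \<in> W"
    and finA: "A \<subseteq> span H" "finite H"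
    and image: "\<And>v. v \<in> W \<Longrightarrow> \<phi> v \<in> A"
  shows "dim {a + \<phi> v | a v. a \<in> A \<and> v \<in> V} + dim W = dim A + dim V"
proof -
  interpret \<phi>: Vector_Spaces.linear scale scale \<phi> by (rule lin)
  obtain B0 where B0: "B0 \<subseteq> W" "independent B0" "W \<subseteq> span B0" "card B0 = dim W"
    using basis_exists by blast
  obtain B where B: "B0 \<subseteq> B" "B \<subseteq> V" "independent B" "V \<subseteq> span B"
    using maximal_independent_subset_extend[of B0 V] B0 WV(1) by blast
  obtain C where C: "C \<subseteq> A" "independent C" "A \<subseteq> span C" "card C = dim A"
    using basis_exists by blast
  have finB: "finite B"
    using independent_span_bound[OF WV(3) B(3)] B(2) WV(2) by blast
  have finC: "finite C"
    using independent_span_bound[OF finA(2) C(2)] C(1) finA(1) by blast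
  have span_eq: "span B0 = W" "span B = V" "span C = A"
    using span_subspace[OF B0(1,3) sub(2)] span_subspace[OF B(2,4) sub(3)]
      span_subspace[OF C(1,3) sub(1)] by simp_all
  \<comment> \<open>The vectors that extend a basis of \<open>W\<close> to one of \<open>V\<close>
    have images independent modulo \<open>A\<close>; they are added one at a time.\<close>
  have ind: "independent (C \<union> \<phi> ` E) \<and> card (C \<union> \<phi> ` E) = card C + card E"
    if "E \<subseteq> B - B0" for E
    using finite_subset[OF that finite_Diff[OF finB]] that
  proof (induction E rule: finite_induct)
    case empty
    then show ?case using C by simp
  next
    case (insert e E)
    have IH: "independent (C \<union> \<phi> ` E)" "card (C \<union> \<phi> ` E) = card C + card E"
      using insert by auto
    \<comment> \<open>Otherwise \<open>e - v\<close> lies in the kernel \<open>W\<close> for some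
      \<open>v\<close> in the span of \<open>E\<close>, so \<open>e\<close> depends on the other
      vectors of \<open>B\<close>.\<close>
    have notin: "\<phi> e \<notin> span (C \<union> \<phi> ` E)"
    proof
      assume "\<phi> e \<in> span (C \<union> \<phi> ` E)"
      then obtain a v where av: "a \<in> A" "v \<in> span E" "\<phi> e = a + \<phi> v"
        unfolding span_Un span_eq \<phi>.span_image by auto
      have "e \<in> B" "E \<subseteq> B" using insert.prems by auto
      then have "e - v \<in> V"
        using av(2) B(2) span_eq(2) span_base span_diff span_mono by blast
      moreover have "\<phi> (e - v) = a" using av(3) by (simp add: \<phi>.diff)
      ultimately have "e - v \<in> span B0" using preimage av(1) span_eq by auto
      then have "v + (e - v) \<in> span (B0 \<union> E)"
        using av(2) by (meson span_add span_mono subsetD sup_ge1 sup_ge2)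
      then have "e \<in> span (B0 \<union> E)" by simp
      moreover have "B0 \<union> E \<subseteq> B - {e}" using insert.prems insert.hyps B(1) by auto
      ultimately have "e \<in> span (B - {e})" using span_mono by blast
      then show False using B(3) \<open>e \<in> B\<close> by (auto simp: dependent_def)
    qed
    then have "\<phi> e \<notin> C \<union> \<phi> ` E" using span_base by metis
    then show ?case
      using IH notin insert.hyps finC by (simp add: independent_insert)
  qed
  let ?E = "B - B0"
  have "span (C \<union> \<phi> ` ?E) = {a + \<phi> v | a v. a \<in> A \<and> v \<in> V}"
  proof (intro equalityI subsetI)
    fix x assume "x \<in> span (C \<union> \<phi> ` ?E)"
    then show "x \<in> {a + \<phi> v | a v. a \<in> A \<and> v \<in> V}"
      unfolding span_Un span_eq \<phi>.span_image using span_mono[of ?E B] span_eq by auto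
  next
    fix x assume "x \<in> {a + \<phi> v | a v. a \<in> A \<and> v \<in> V}"
    then obtain a v where x: "x = a + \<phi> v" "a \<in> span C" "v \<in> span (B0 \<union> ?E)"
      using span_eq B(1) by (auto simp: Un_absorb1)
    then obtain w u where v: "v = w + u" "w \<in> span B0" "u \<in> span ?E"
      unfolding span_Un by auto
    have "\<phi> w \<in> span C" using v(2) image span_eq by auto
    then have "a + \<phi> w \<in> span C" using x(2) by (rule span_add[rotated])
    moreover have "\<phi> u \<in> span (\<phi> ` ?E)" using v(3) by (simp add: \<phi>.span_image)
    ultimately have "(a + \<phi> w) + \<phi> u \<in> span (C \<union> \<phi> ` ?E)"
      unfolding span_Un by blast
    then show "x \<in> span (C \<union> \<phi> ` ?E)" using x v by (simp add: \<phi>.add algebra_simps)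
  qed
  then have "dim {a + \<phi> v | a v. a \<in> A \<and> v \<in> V} = card C + card ?E"
    using ind[of ?E] by (metis dim_span_eq_card_independent order_refl)
  moreover have "card ?E + card B0 = card B"
    using B(1) finB by (metis card_Diff_subset card_mono finite_subset le_add_diff_inverse2)
  moreover have "card B = dim V" using B by (simp add: basis_card_eq_dim)
  ultimately show ?thesis using B0(4) C(4) by simp
qed

section \<open>Graded pieces of the polynomial ring\<close>

interpretation poly: vector_space "scale :: 'k::field \<Rightarrow> ('n, 'k) mpoly \<Rightarrow> _"
  by (rule vector_space_scale)

interpretation ring: module "(*) :: ('n, 'k::field) mpoly \<Rightarrow> _"
  by (rule module_times)

lemma lookup_scale [simp]:
  "Poly_Mapping.lookup (scale c p) t = c * Poly_Mapping.lookup p t"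
  unfolding scale_def by (simp flip: mult_map_scale_conv_mult add: Poly_Mapping.map.rep_eq when_def)

lemma total_degree_add: "total_degree (s + t) = total_degree s + total_degree t"
  by (simp add: total_degree_def lookup_add sum.distrib)

text \<open>Exponent vectors of degree \<open>d\<close> are the multiplicity functions of multisets
  of \<open>d\<close> variables, so stars and bars counts them.\<close>

lemma finite_total_degree: "finite {t :: 'n::finite \<Rightarrow>\<^sub>0 nat. total_degree t = d}"
  and card_total_degree:
    "card {t :: 'n::finite \<Rightarrow>\<^sub>0 nat. total_degree t = d} = (CARD('n) + d - 1) choose d"
proof -
  let ?g = "\<lambda>X :: 'n multiset. Abs_poly_mapping (count X)"
  have lookup: "Poly_Mapping.lookup (?g X) = count X" for X
    by simp
  have "bij_betw ?g (multisets_of_size UNIV d) {t. total_degree t = d}"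
    unfolding bij_betw_def
  proof (intro conjI equalityI subsetI)
    show "inj_on ?g (multisets_of_size UNIV d)"
      by (rule inj_onI) (metis lookup multiset_eqI)
  next
    fix t assume "t \<in> ?g ` multisets_of_size UNIV d"
    then show "t \<in> {t. total_degree t = d}"
      by (auto simp: multisets_of_size_def total_degree_def size_multiset_overloaded_eq
          intro!: sum.mono_neutral_right simp: not_in_iff)
  next
    fix t :: "'n \<Rightarrow>\<^sub>0 nat" assume t: "t \<in> {t. total_degree t = d}"
    let ?X = "Abs_multiset (Poly_Mapping.lookup t)"
    have c: "count ?X = Poly_Mapping.lookup t" by (simp add: Abs_multiset_inverse)
    have "size ?X = (\<Sum>x\<in>UNIV. count ?X x)"
      unfolding size_multiset_overloaded_eq by (rule sum.mono_neutral_left) (auto simp: not_in_iff)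
    then have "?X \<in> multisets_of_size UNIV d"
      using t by (simp add: multisets_of_size_def total_degree_def c)
    moreover have "t = ?g ?X" by (simp add: c)
    ultimately show "t \<in> ?g ` multisets_of_size UNIV d" by blast
  qed
  note bij = this
  show "finite {t :: 'n \<Rightarrow>\<^sub>0 nat. total_degree t = d}"
    using bij_betw_finite[OF bij] by auto
  show "card {t :: 'n \<Rightarrow>\<^sub>0 nat. total_degree t = d} = (CARD('n) + d - 1) choose d"
    using bij_betw_same_card[OF bij] by (simp add: card_multisets_of_size)
qed

definition monomials :: "nat \<Rightarrow> ('n::finite, 'k::field) mpoly set" where
  "monomials d = (\<lambda>t. Poly_Mapping.single t 1) ` {t. total_degree t = d}"

lemma finite_monomials: "finite (monomials d)"
  by (simp add: monomials_def finite_total_degree)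

lemma subspace_homog_part: "poly.subspace (homog_part d)"
proof (rule poly.subspaceI)
  show "p + q \<in> homog_part d" if "p \<in> homog_part d" "q \<in> homog_part d" for p q
    using that keys_add[of p q] by (auto simp: homog_part_def)
qed (auto simp: homog_part_def in_keys_iff)

lemma monomials_subset: "monomials d \<subseteq> homog_part d"
  by (auto simp: monomials_def homog_part_def)

lemma poly_mapping_expand:
  "p = (\<Sum>t\<in>Poly_Mapping.keys p. scale (Poly_Mapping.lookup p t) (Poly_Mapping.single t 1))"
  by (rule poly_mapping_eqI)
     (auto simp: lookup_sum lookup_single when_def in_keys_iff if_distrib cong: if_cong)

lemma homog_part_subset_span: "homog_part d \<subseteq> poly.span (monomials d)"
proof
  fix p :: "('a, 'b) mpoly" assume "p \<in> homog_part d"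
  then show "p \<in> poly.span (monomials d)"
    by (subst poly_mapping_expand)
       (intro poly.span_sum poly.span_scale poly.span_base, auto simp: monomials_def homog_part_def)
qed

lemma independent_monomials: "poly.independent (monomials d :: ('n::finite, 'k::field) mpoly set)"
proof
  assume "poly.dependent (monomials d :: ('n, 'k) mpoly set)"
  then obtain u and v :: "('n, 'k) mpoly" where v: "v \<in> monomials d" "u v \<noteq> 0"
    and 0: "(\<Sum>p\<in>monomials d. scale (u p) p) = 0"
    unfolding poly.dependent_finite[OF finite_monomials] by blast
  from v obtain t where t: "v = Poly_Mapping.single t 1" by (auto simp: monomials_def)
  have "Poly_Mapping.lookup (\<Sum>p\<in>monomials d. scale (u p) p) t
      = (\<Sum>p\<in>monomials d. if p = v then u v else 0)"
    unfolding lookup_sum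
    by (rule sum.cong) (auto simp: t monomials_def lookup_single when_def split: if_splits)
  then show False using v by (simp add: 0 finite_monomials)
qed

lemma dim_homog_part:
  "poly.dim (homog_part d :: ('n::finite, 'k::field) mpoly set) = (CARD('n) + d - 1) choose d"
proof -
  have "inj (\<lambda>t :: 'n \<Rightarrow>\<^sub>0 nat. Poly_Mapping.single t (1::'k))"
    by (rule injI) (metis lookup_single_eq lookup_single_not_eq zero_neq_one)
  then have "card (monomials d :: ('n, 'k) mpoly set) = (CARD('n) + d - 1) choose d"
    unfolding monomials_def
    by (subst card_image) (auto simp: card_total_degree intro: inj_on_subset)
  then show ?thesis
    using poly.dim_unique[OF monomials_subset homog_part_subset_span independent_monomials] by blast
qed

lift_definition component :: "nat \<Rightarrow> ('n::finite, 'k::field) mpoly \<Rightarrow> ('n, 'k) mpoly"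
  is "\<lambda>d p t. p t when total_degree t = d"
  by (erule finite_subset[rotated]) (auto simp: when_def)

lemma component_add: "component d (p + q) = component d p + component d q"
  by (rule poly_mapping_eqI) (simp add: component.rep_eq lookup_add when_add_distrib)

lemma component_0 [simp]: "component d 0 = 0"
  by (rule poly_mapping_eqI) (simp add: component.rep_eq)

lemma component_in_homog_part: "component d p \<in> homog_part d"
  by (auto simp: homog_part_def in_keys_iff component.rep_eq when_def split: if_splits)

lemma component_homog: "p \<in> homog_part e \<Longrightarrow> component d p = (if d = e then p else 0)"
  by (rule poly_mapping_eqI) (auto simp: homog_part_def in_keys_iff component.rep_eq when_def)

lemma homog_part_mult: "p \<in> homog_part d \<Longrightarrow> q \<in> homog_part e \<Longrightarrow> p * q \<in> homog_part (d + e)"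
  using keys_mult[of p q] by (fastforce simp: homog_part_def total_degree_add)

text \<open>Multiplication by a homogeneous \<open>f\<close> shifts degrees by \<open>e\<close>.
  This is clear for a single term and extends to \<open>q\<close> by additivity.\<close>

lemma component_mult:
  assumes f: "f \<in> homog_part e"
  shows "component d (q * f) = (if e \<le> d then component (d - e) q * f else 0)"
proof -
  have single: "component d (Poly_Mapping.single t c * f) =
      (if e \<le> d then component (d - e) (Poly_Mapping.single t c) * f else 0)" for t c
  proof -
    have "Poly_Mapping.single t c \<in> homog_part (total_degree t)"
      by (auto simp: homog_part_def)
    from component_homog[OF this] component_homog[OF homog_part_mult[OF this f]]
    show ?thesis by auto
  qed
  have sum: "component d (sum g T) = (\<Sum>t\<in>T. component d (g t))" if "finite T"
    for d T and g :: "_ \<Rightarrow> ('a, 'b) mpoly"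
    using that by (induction T rule: finite_induct) (auto simp: component_add)
  let ?s = "\<lambda>t. Poly_Mapping.single t (Poly_Mapping.lookup q t)"
  have q: "q = sum ?s (Poly_Mapping.keys q)"
    by (rule poly_mapping_eqI)
       (auto simp: lookup_sum lookup_single when_def in_keys_iff if_distrib cong: if_cong)
  have "component d (q * f) = (\<Sum>t\<in>Poly_Mapping.keys q. component d (?s t * f))"
    by (subst (1) q) (simp add: sum_distrib_right sum)
  also have "\<dots> = (if e \<le> d then (\<Sum>t\<in>Poly_Mapping.keys q. component (d - e) (?s t)) * f else 0)"
    by (simp add: single sum_distrib_right)
  also have "(\<Sum>t\<in>Poly_Mapping.keys q. component (d - e) (?s t)) = component (d - e) q"
    by (subst (3) q) (simp add: sum)
  finally show ?thesis .
qed

section \<open>Homogeneous ideals and multiplication by a quadric\<close>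

text \<open>A component of \<open>c * f\<close> is again a multiple of the homogeneous generator
  \<open>f\<close>, or zero, and taking components is additive.\<close>

lemma component_ideal:
  assumes F: "F \<subseteq> homog_part 2" and p: "p \<in> ideal F"
  shows "component d p \<in> ideal F"
  using p unfolding ideal_def
proof (induction rule: ring.span_induct_alt)
  case base
  then show ?case by (simp add: ring.span_zero)
next
  case (step c f q)
  have "component d (c * f) \<in> ring.span F"
    using ring.span_scale[OF ring.span_base[OF step(1)]]
    by (simp add: component_mult[OF subsetD[OF F step(1)]] ring.span_zero)
  then show ?case using step by (simp add: component_add ring.span_add)
qed

lemma scale_mult: "scale c p * q = scale c (p * q)"
  unfolding scale_def by (rule mult.assoc)

lemma ideal_scale: "p \<in> ideal F \<Longrightarrow> scale c p \<in> ideal F"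
  unfolding ideal_def scale_def by (rule ring.span_scale)

lemma subspace_ideal: "poly.subspace (ideal F)"
proof (rule poly.subspaceI)
  show "0 \<in> ideal F" unfolding ideal_def by (rule ring.span_zero)
  show "p + q \<in> ideal F" if "p \<in> ideal F" "q \<in> ideal F" for p q
    using that unfolding ideal_def by (rule ring.span_add)
qed (rule ideal_scale)

text \<open>Comparing components in \<open>p = a + q * f\<close> lets \<open>q\<close> be replaced
  by its part of degree \<open>d\<close>, which gives the shape required by
  \<open>dim_add_image\<close>. In degrees below 2 a multiple of \<open>f\<close> has no
  component.\<close>

lemma ideal_insert_homog:
  assumes F: "F \<subseteq> homog_part 2" and f: "f \<in> homog_part 2"
  shows "ideal (insert f F) \<inter> homog_part (d + 2) =
    {a + v * f | a v. a \<in> ideal F \<inter> homog_part (d + 2) \<and> v \<in> homog_part d}" (is "?L = ?R")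
    and "d < 2 \<Longrightarrow> ideal (insert f F) \<inter> homog_part d = ideal F \<inter> homog_part d"
proof -
  have decomp: "\<exists>a\<in>ideal F \<inter> homog_part e. p = a + component e (q * f)"
    if "p \<in> homog_part e" "p - q * f \<in> ideal F" for p q e
  proof -
    have "p = component e ((p - q * f) + q * f)"
      using component_homog[OF that(1)] by simp
    also have "\<dots> = component e (p - q * f) + component e (q * f)"
      by (rule component_add)
    finally show ?thesis
      using component_ideal[OF F that(2)] component_in_homog_part by blast
  qed
  show "?L = ?R"
  proof (intro equalityI subsetI)
    fix p assume "p \<in> ?L"
    then obtain q where "p \<in> homog_part (d + 2)" "p - q * f \<in> ideal F"
      unfolding ideal_def ring.span_insert by auto
    from decomp[OF this] obtain a
      where "a \<in> ideal F \<inter> homog_part (d + 2)" "p = a + component d q * f"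
      by (auto simp: component_mult[OF f])
    then show "p \<in> ?R" using component_in_homog_part[of d q] by blast
  next
    fix p assume "p \<in> ?R"
    then obtain a v where p: "p = a + v * f" "a \<in> ideal F" "a \<in> homog_part (d + 2)"
      "v \<in> homog_part d" by blast
    then have "p \<in> homog_part (d + 2)"
      using homog_part_mult[OF p(4) f] by (simp add: poly.subspace_add[OF subspace_homog_part])
    moreover have "p - v * f \<in> ideal F" using p by simp
    ultimately show "p \<in> ?L" unfolding ideal_def ring.span_insert by blast
  qed
  show "ideal (insert f F) \<inter> homog_part d = ideal F \<inter> homog_part d" if "d < 2"
  proof (intro equalityI subsetI)
    fix p assume p: "p \<in> ideal (insert f F) \<inter> homog_part d"
    then obtain q where "p \<in> homog_part d" "p - q * f \<in> ideal F"
      unfolding ideal_def ring.span_insert by auto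
    from decomp[OF this] show "p \<in> ideal F \<inter> homog_part d"
      using that by (auto simp: component_mult[OF f])
  next
    fix p assume "p \<in> ideal F \<inter> homog_part d"
    then show "p \<in> ideal (insert f F) \<inter> homog_part d"
      unfolding ideal_def using ring.span_mono[of F "insert f F"] by blast
  qed
qed

lemma coset_eq_iff: "coset (ideal F) p = coset (ideal F) q \<longleftrightarrow> p - q \<in> ideal F"
proof
  assume eq: "coset (ideal F) p = coset (ideal F) q"
  have "p \<in> coset (ideal F) p"
    unfolding coset_def by (rule image_eqI[of _ _ 0]) (simp_all add: ideal_def ring.span_zero)
  then show "p - q \<in> ideal F" unfolding eq by (auto simp: coset_def)
next
  have le: "coset (ideal F) p \<subseteq> coset (ideal F) q" if "p - q \<in> ideal F" for p q
  proof
    fix x assume "x \<in> coset (ideal F) p"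
    then have "x - p \<in> ideal F" by (auto simp: coset_def)
    then have "(x - p) + (p - q) \<in> ideal F"
      using that unfolding ideal_def by (rule ring.span_add)
    then have "x - q \<in> ideal F" by simp
    then show "x \<in> coset (ideal F) q"
      unfolding coset_def by (intro image_eqI[of _ _ "x - q"]) simp_all
  qed
  assume "p - q \<in> ideal F"
  moreover from this have "q - p \<in> ideal F"
    unfolding ideal_def using ring.span_neg[of "p - q"] by simp
  ultimately show "coset (ideal F) p = coset (ideal F) q" using le by blast
qed

text \<open>The cosets of \<open>g\<close> and 0 have the same image, so injectivity identifies
  them: the kernel is trivial in terms of representatives.\<close>

lemma inj_on_quot_multD:
  assumes inj: "inj_on (quot_mult (ideal F) f) (quot_part (ideal F) d)"
    and g: "g \<in> homog_part d" "g * f \<in> ideal F"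
  shows "g \<in> ideal F"
proof -
  have "0 \<in> homog_part d" by (simp add: homog_part_def)
  then have "coset (ideal F) g \<in> quot_part (ideal F) d" "coset (ideal F) 0 \<in> quot_part (ideal F) d"
    using g by (auto simp: quot_part_def)
  moreover have "quot_mult (ideal F) f (coset (ideal F) g) = quot_mult (ideal F) f (coset (ideal F) 0)"
    using g by (simp add: quot_mult_coset coset_eq_iff)
  ultimately have "coset (ideal F) g = coset (ideal F) 0"
    using inj by (meson inj_onD)
  then show ?thesis by (simp add: coset_eq_iff)
qed

section \<open>The Hilbert function, one quadric at a time\<close>

text \<open>Coefficient of \<open>z\<^sup>d\<close> in \<open>(1 - z\<^sup>2)\<^sup>i / (1 - z)\<^sup>n\<close>.\<close>

fun semi_regular_coeff :: "nat \<Rightarrow> nat \<Rightarrow> nat \<Rightarrow> int" where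
  "semi_regular_coeff n 0 d = int ((n + d - 1) choose d)"
| "semi_regular_coeff n (Suc i) d =
     semi_regular_coeff n i d - (if d < 2 then 0 else semi_regular_coeff n i (d - 2))"

text \<open>Multiplication by \<open>f\<close> from degree \<open>d\<close> to degree
  \<open>d + 2\<close> modulo the ideal has kernel \<open>ideal F \<inter> homog_part d\<close> by
  injectivity, so \<open>dim_add_image\<close> applies.\<close>

lemma dim_ideal_part_insert:
  fixes f :: "('n::finite, 'k::field) mpoly"
  assumes F: "F \<subseteq> homog_part 2" and f: "f \<in> homog_part 2"
    and inj: "inj_on (quot_mult (ideal F) f) (quot_part (ideal F) d)"
  shows "poly.dim (ideal (insert f F) \<inter> homog_part (d + 2)) + poly.dim (ideal F \<inter> homog_part d)
    = poly.dim (ideal F \<inter> homog_part (d + 2)) + poly.dim (homog_part d :: ('n, 'k) mpoly set)"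
proof (subst ideal_insert_homog(1)[OF F f], rule poly.dim_add_image[where \<phi> = "\<lambda>v. v * f" and A = "ideal F \<inter> homog_part (d + 2)"
      and W = "ideal F \<inter> homog_part d" and V = "homog_part d"
      and G = "monomials d" and H = "monomials (d + 2)"])
  show "Vector_Spaces.linear scale scale (\<lambda>v. v * f)"
    unfolding Vector_Spaces.linear_iff by (simp add: vector_space_scale scale_mult distrib_right)
  show "poly.subspace (ideal F \<inter> homog_part (d + 2))" "poly.subspace (ideal F \<inter> homog_part d)"
    by (simp_all add: poly.subspace_inter subspace_ideal subspace_homog_part)
  show "poly.subspace (homog_part d)" by (rule subspace_homog_part)
  show "homog_part d \<subseteq> poly.span (monomials d)" "finite (monomials d)"
    by (rule homog_part_subset_span, rule finite_monomials)
  show "ideal F \<inter> homog_part (d + 2) \<subseteq> poly.span (monomials (d + 2))" "finite (monomials (d + 2))"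
    using homog_part_subset_span[of "d + 2"] finite_monomials by auto
  show "v \<in> ideal F \<inter> homog_part d"
    if "v \<in> homog_part d" "v * f \<in> ideal F \<inter> homog_part (d + 2)" for v
    using that inj_on_quot_multD[OF inj] by blast
  show "v * f \<in> ideal F \<inter> homog_part (d + 2)" if "v \<in> ideal F \<inter> homog_part d" for v
  proof -
    have "f * v \<in> ideal F" using that unfolding ideal_def by (simp add: ring.span_scale)
    then show ?thesis using that homog_part_mult[of v d f 2] f by (simp add: mult.commute)
  qed
qed simp

text \<open>Below the degree of regularity each new quadric multiplies the Hilbert series by
  \<open>1 - z^2\<close>, which is the recursion of \<open>semi_regular_coeff\<close>.\<close>

lemma dim_quotient_semi_regular:
  fixes f :: "nat \<Rightarrow> ('n::finite, 'k::field) mpoly"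
  assumes f: "\<And>i. i \<in> {1..m} \<Longrightarrow> f i \<in> homog_part 2" and "semi_regular m f"
    and "i \<le> m" and "d < degree_of_regularity (ideal (f ` {1..m}))"
  shows "int (poly.dim (homog_part d :: ('n, 'k) mpoly set))
      - int (poly.dim (ideal (f ` {1..i}) \<inter> homog_part d)) = semi_regular_coeff CARD('n) i d"
  using assms(3,4)
proof (induction i arbitrary: d)
  case 0
  have "ideal ({} :: ('n, 'k) mpoly set) \<inter> homog_part d = {0}"
    by (auto simp: ideal_def homog_part_def)
  moreover have "poly.dim {0 :: ('n, 'k) mpoly} = 0"
    using poly.dim_span[of "{} :: ('n, 'k) mpoly set"]
      poly.dim_eq_card_independent[of "{} :: ('n, 'k) mpoly set"] poly.independent_empty by simp
  ultimately show ?case by (simp add: dim_homog_part)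
next
  case (Suc i)
  let ?F = "f ` {1..i}"
  have F: "?F \<subseteq> homog_part 2" and fi: "f (Suc i) \<in> homog_part 2"
    using f Suc.prems(1) by auto
  have ins: "f ` {1..Suc i} = insert (f (Suc i)) ?F"
    by (simp add: atLeastAtMostSuc_conv)
  show ?case
  proof (cases "d < 2")
    case True
    then show ?thesis
      unfolding ins ideal_insert_homog(2)[OF F fi True] using Suc.IH[of d] Suc.prems by simp
  next
    case False
    \<comment> \<open>The bound on \<open>d\<close> is
      \<open>e + 2 < degree_of_regularity ...\<close>, exactly the range where semi-regularity gives
      injectivity.\<close>
    define e where "e = d - 2"
    have d: "d = e + 2" using False by (simp add: e_def)
    have "inj_on (quot_mult (ideal ?F) (f (Suc i))) (quot_part (ideal ?F) e)"
      using assms(2) Suc.prems unfolding semi_regular_def d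
      by (metis atLeastAtMost_iff atLeastLessThanSuc_atLeastAtMost le_add1 plus_1_eq_Suc)
    from dim_ideal_part_insert[OF F fi this]
    show ?thesis
      using Suc.IH[of d] Suc.IH[of e] Suc.prems False unfolding ins d by simp
  qed
qed

text \<open>By minimality of the degree of regularity the ideal is a proper part of the polynomials
  of degree \<open>d\<close>, so the quotient is nonzero there.\<close>

lemma semi_regular_coeff_pos:
  fixes f :: "nat \<Rightarrow> ('n::finite, 'k::field) mpoly"
  assumes f: "\<And>i. i \<in> {1..m} \<Longrightarrow> f i \<in> homog_part 2" and sr: "semi_regular m f"
    and d: "d < degree_of_regularity (ideal (f ` {1..m}))"
  shows "semi_regular_coeff CARD('n) m d > 0"
proof -
  let ?J = "ideal (f ` {1..m}) \<inter> homog_part d"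
  have "poly.dim ?J \<noteq> poly.dim (homog_part d :: ('n, 'k) mpoly set)"
    using not_less_Least[OF d[unfolded degree_of_regularity_def]] .
  moreover have "poly.dim ?J \<le> poly.dim (homog_part d :: ('n, 'k) mpoly set)"
  proof -
    obtain B :: "('n, 'k) mpoly set" where B: "B \<subseteq> homog_part d" "poly.independent B"
      "homog_part d \<subseteq> poly.span B" "card B = poly.dim (homog_part d :: ('n, 'k) mpoly set)"
      using poly.basis_exists by blast
    have "finite B"
      using poly.independent_span_bound[OF finite_monomials B(2)] B(1) homog_part_subset_span by blast
    then show ?thesis using poly.dim_le_card[of ?J B] B by force
  qed
  ultimately show ?thesis
    using dim_quotient_semi_regular[OF f sr order_refl d] by linarith
qed

section \<open>The recurrence for the coefficients\<close>

text \<open>The series \<open>F = (1 - z^2)^i / (1 - z)^n\<close> satisfies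
  \<open>(1 - z^2) F' = (n + n z - 2 i z) F\<close>; this is its coefficient at
  \<open>z^(k + 1)\<close>. The proof is by induction on \<open>i\<close>.\<close>

lemma semi_regular_coeff_rec:
  assumes "n \<ge> 1"
  shows "int (k + 2) * semi_regular_coeff n i (k + 2) =
    int n * semi_regular_coeff n i (k + 1) - (2 * int i - int n - int k) * semi_regular_coeff n i k"
    and "semi_regular_coeff n i 0 = 1" and "semi_regular_coeff n i 1 = int n"
proof (induction i arbitrary: k)
  case 0
  obtain n' where n: "n = Suc n'" using assms by (cases n) auto
  \<comment> \<open>Absorption: for \<open>i = 0\<close> the coefficients satisfy a first-order
    recurrence, used at \<open>k\<close> and at \<open>k + 1\<close>.\<close>
  have *: "int (Suc k) * int (Suc (n' + k) choose Suc k) = int (Suc (n' + k)) * int ((n' + k) choose k)" for k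
    using Suc_times_binomial_eq[of "n' + k" k] by (simp only: mult.commute flip: of_nat_mult)
  {
    case 1
    show ?case using *[of k] *[of "Suc k"] by (simp add: n algebra_simps)
  next
    case 2
    show ?case by simp
  next
    case 3
    show ?case by (simp add: n)
  }
next
  case (Suc i)
  {
    case 1
    \<comment> \<open>For \<open>k >= 2\<close> subtract the recurrence at \<open>k - 2\<close> from
      the one at \<open>k\<close>; for smaller \<open>k\<close> there is no coefficient at
      \<open>k - 2\<close>.\<close>
    have k: "k = 0 \<or> k = 1 \<or> (\<exists>k'. k = k' + 2)" by presburger
    then show ?case
    proof (elim disjE exE)
      assume "k = 0"
      then show ?thesis using Suc(1)[of 0] Suc(2,3) by simp
    next
      assume "k = 1"
      then show ?thesis using Suc(1)[of 1] Suc(2,3)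
        by (simp add: algebra_simps numeral_3_eq_3[symmetric])
    next
      fix k' assume k': "k = k' + 2"
      have 4: "Suc (Suc (Suc (Suc k'))) - 2 = k' + 2" "Suc (Suc (Suc k')) - 2 = k' + 1" by simp_all
      show ?thesis using Suc(1)[of k] Suc(1)[of k'] unfolding k'
        by (simp add: algebra_simps 4)
    qed
  next
    case 2
    show ?case using Suc(2) by simp
  next
    case 3
    show ?case using Suc(3) by simp
  }
qed

section \<open>The sextic\<close>

text \<open>\<open>g\<close> is the sextic without its constant term: it has the same maximizers,
  and its sign is visible from its factors.\<close>

context
  fixes m n :: nat and N :: real and g :: "real \<Rightarrow> real"
  assumes mn: "m > n" "n \<ge> 1"
  defines "N \<equiv> 2 * real m - real n"
  defines "g \<equiv> \<lambda>x. x * (x - 1)\<^sup>2 * (N - x ^ 3)"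
begin

lemma N_ge: "N \<ge> 3"
  using mn by (simp add: N_def)

lemma sextic_eq: "sextic m n x = g x - (real n)\<^sup>2 / 4"
  by (simp add: sextic_def g_def N_def)

lemma root_N: "root 3 N > 1" "root 3 N ^ 3 = N"
  using N_ge by simp_all

lemma g_pos: "1 < x \<Longrightarrow> x < root 3 N \<Longrightarrow> g x > 0"
  using root_N power_strict_mono[of x "root 3 N" 3] by (simp add: g_def)

lemma g_nonpos:
  assumes "root 3 N \<le> x"
  shows "g x \<le> 0"
proof -
  have "0 \<le> x" "N \<le> x ^ 3"
    using assms root_N power_mono[of "root 3 N" x 3] by linarith+
  then show ?thesis unfolding g_def by (intro mult_nonneg_nonpos mult_nonneg_nonneg) auto
qed

text \<open>With \<open>x - 1\<close> split off, the second factor alone decides the sign beyond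
  1.\<close>

lemma DERIV_g:
  "(g has_real_derivative (x - 1) * ((3 * x - 1) * N - x ^ 3 * (6 * x - 4))) (at x)"
  unfolding g_def
  by (auto intro!: derivative_eq_intros)
     (simp add: algebra_simps power2_eq_square power3_eq_cube power4_eq_xxxx)

lemma continuous_on_sextic: "continuous_on S (sextic m n)"
  unfolding sextic_def by (intro continuous_intros)

text \<open>Compactness gives a maximum on \<open>{1..root 3 N}\<close>. It is interior and global
  because \<open>g\<close> is positive inside, zero at 1 and nonpositive from
  \<open>root 3 N\<close> on.\<close>

lemma sextic_attains_max:
  "\<exists>x\<in>{1<..<root 3 N}. \<forall>y\<in>{1<..}. sextic m n y \<le> sextic m n x"
proof -
  let ?r = "root 3 N"
  obtain x where x: "x \<in> {1..?r}" "\<forall>y\<in>{1..?r}. sextic m n y \<le> sextic m n x"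
    using continuous_attains_sup[OF compact_Icc _ continuous_on_sextic, of 1 ?r] root_N by auto
  have "g ((1 + ?r) / 2) > 0" using g_pos[of "(1 + ?r) / 2"] root_N by simp
  moreover have "g ((1 + ?r) / 2) \<le> g x" using x(2) root_N by (simp add: sextic_eq)
  ultimately have pos: "g x > 0" by simp
  moreover have "g 1 = 0" by (simp add: g_def)
  ultimately have "x \<in> {1<..<?r}" using x(1) g_nonpos[of x]
    by (cases "x = 1"; cases "?r \<le> x") auto
  moreover have "sextic m n y \<le> sextic m n x" if "y > 1" for y
    using x(2) that g_nonpos[of y] pos by (cases "y \<le> ?r") (auto simp: sextic_eq)
  ultimately show ?thesis by (intro bexI[of _ x]) auto
qed

text \<open>For \<open>x > 1\<close> the derivative has the sign of \<open>N - x\<^sup>3 (6 x - 4) / (3 x - 1)\<close>, which is decreasing.\<close>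

lemma sextic_strict_mono:
  assumes x': "x' > 1" and max: "\<forall>y\<in>{1<..}. sextic m n y \<le> sextic m n x'"
    and ab: "1 < a" "a < b" "b \<le> x'"
  shows "sextic m n a < sextic m n b"
proof -
  have "(x' - 1) * ((3 * x' - 1) * N - x' ^ 3 * (6 * x' - 4)) = 0"
  proof (rule DERIV_local_max[OF DERIV_g, of "x' - 1"])
    show "\<forall>y. \<bar>x' - y\<bar> < x' - 1 \<longrightarrow> g y \<le> g x'"
      using max by (auto simp: sextic_eq)
  qed (use x' in simp)
  then have crit: "(3 * x' - 1) * N = x' ^ 3 * (6 * x' - 4)" using x' by simp
  have "g a < g b"
  proof (rule DERIV_pos_imp_increasing_open[OF ab(2)])
    fix x assume x: "a < x" "x < b"
    have x1: "x > 1" "x < x'" using x ab by auto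
    \<comment> \<open>With denominators cleared: \<open>x ^ 3\<close> increases strictly and
      \<open>(6 * x - 4) / (3 * x - 1)\<close> does not decrease. The equation \<open>crit\<close>
      then eliminates \<open>x'\<close>.\<close>
    have "x ^ 3 * (6 * x - 4) * (3 * x' - 1) < x' ^ 3 * (6 * x' - 4) * (3 * x - 1)"
    proof -
      have "x ^ 3 < x' ^ 3" using x1 by (intro power_strict_mono) auto
      moreover have "(6 * x - 4) * (3 * x' - 1) \<le> (6 * x' - 4) * (3 * x - 1)"
        using x1 by (simp add: algebra_simps)
      moreover have "(6 * x - 4) * (3 * x' - 1) > 0" using x1 by simp
      ultimately show ?thesis
        using x1 mult_less_le_imp_less[of "x ^ 3" "x' ^ 3" "(6 * x - 4) * (3 * x' - 1)"
            "(6 * x' - 4) * (3 * x - 1)"] by (simp add: mult.assoc)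
    qed
    also have "\<dots> = (3 * x - 1) * N * (3 * x' - 1)" using crit by (simp add: mult_ac)
    finally have "x ^ 3 * (6 * x - 4) < (3 * x - 1) * N" using x1 by simp
    then show "\<exists>y. (g has_real_derivative y) (at x) \<and> y > 0"
      using DERIV_g x1 by (intro exI conjI) auto
  next
    show "continuous_on {a..b} g" unfolding g_def by (intro continuous_intros)
  qed
  then show ?thesis by (simp add: sextic_eq)
qed

text \<open>The value at 1 is negative, so the intermediate value theorem gives a root; strict
  monotonicity up to \<open>x'\<close> makes it unique.\<close>

lemma sextic_unique_root:
  assumes x': "x' > 1" and max: "\<forall>y\<in>{1<..}. sextic m n y \<le> sextic m n x'"
    and nonneg: "sextic m n x' \<ge> 0"
  shows "\<exists>!x. x \<in> {1<..x'} \<and> sextic m n x = 0"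
proof (rule ex_ex1I)
  have neg: "sextic m n 1 < 0" using mn by (simp add: sextic_def)
  then obtain x where x: "1 \<le> x" "x \<le> x'" "sextic m n x = 0"
    using IVT'[of "sextic m n" 1 0 x'] nonneg x' continuous_on_sextic by auto
  moreover have "x \<noteq> 1" using neg x by auto
  ultimately show "\<exists>x. x \<in> {1<..x'} \<and> sextic m n x = 0" by force
next
  fix x y assume "x \<in> {1<..x'} \<and> sextic m n x = 0" "y \<in> {1<..x'} \<and> sextic m n y = 0"
  then show "x = y"
    using sextic_strict_mono[OF x' max, of x y] sextic_strict_mono[OF x' max, of y x]
    by (cases x y rule: linorder_cases) auto
qed

end

section \<open>Positivity in a three-term recurrence\<close>

text \<open>A positive Sturm sequence bounds the quadratic form of its Jacobi matrix at the indicator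
  vector of \<open>{L..M}\<close>.\<close>

lemma three_term_rec_window_bound:
  fixes h :: "nat \<Rightarrow> real" and b N :: real
  assumes rec0: "h 1 = b * h 0"
    and rec: "\<And>k. real (k + 2) * h (k + 2) = b * h (k + 1) - (N - real k) * h k"
    and pos: "\<And>k. k \<le> M + 1 \<Longrightarrow> h k > 0" and LM: "L \<le> M" and MN: "real M \<le> N"
  shows "2 * (\<Sum>k = L..<M. sqrt (real (k + 1) * (N - real k))) < b * real (M + 1 - L)"
proof -
  \<comment> \<open>The weights are chosen so that the recurrence divided by
    \<open>h (k + 1)\<close> reads \<open>u (Suc k) + v k = b\<close>, while \<open>h\<close>
    cancels from \<open>u k * v k\<close>.\<close>
  define u where "u k = real (k + 1) * h (k + 1) / h k" for k
  define v where "v k = (N - real k) * h k / h (k + 1)" for k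
  \<comment> \<open>At the lower end of the window the nonnegative term from the index before it is
    dropped.\<close>
  have start: "u k \<le> b" if "k \<le> M" for k
  proof (cases k)
    case 0
    then show ?thesis using rec0 pos[of 0] by (simp add: u_def)
  next
    case (Suc j)
    have "(N - real j) * h j \<ge> 0" using that Suc MN pos[of j] by (intro mult_nonneg_nonneg) auto
    then have "real (j + 2) * h (j + 2) \<le> b * h (j + 1)" using rec[of j] by simp
    then show ?thesis using Suc pos[of "j + 1"] that
      by (simp add: u_def pos_divide_le_eq add.commute)
  qed
  have rec_sum: "u (Suc k) + v k = b" if "k < M" for k
  proof -
    have "u (Suc k) + v k = (real (k + 2) * h (k + 2) + (N - real k) * h k) / h (k + 1)"
      by (simp add: u_def v_def add_divide_distrib)
    then show ?thesis using rec[of k] pos[of "k + 1"] that by simp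
  qed
  have amgm: "2 * sqrt (real (k + 1) * (N - real k)) \<le> u k + v k" if "k < M" for k
  proof -
    have p: "h k > 0" "h (k + 1) > 0" using pos that by auto
    then have "u k \<ge> 0" "v k \<ge> 0" using MN that by (auto simp: u_def v_def)
    moreover have "u k * v k = real (k + 1) * (N - real k)" using p by (simp add: u_def v_def)
    ultimately show ?thesis using arith_geo_mean_sqrt[of "u k" "v k"] by simp
  qed
  \<comment> \<open>The top ratio \<open>u K\<close> is carried along unpaired; at
    \<open>K = M\<close> its positivity makes the final inequality strict.\<close>
  have "u K + 2 * (\<Sum>k = L..<K. sqrt (real (k + 1) * (N - real k))) \<le> b * real (K + 1 - L)"
    if "L \<le> K" "K \<le> M" for K
    using that
  proof (induction K rule: dec_induct)
    case base
    then show ?case using start[of L] by simp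
  next
    case (step K)
    have *: "real (Suc K + 1 - L) = real (K + 1 - L) + 1" using step.hyps by simp
    have "u (Suc K) + 2 * (\<Sum>k = L..<Suc K. sqrt (real (k + 1) * (N - real k)))
        \<le> u (Suc K) + (2 * (\<Sum>k = L..<K. sqrt (real (k + 1) * (N - real k))) + (u K + v K))"
      using amgm[of K] step.hyps step.prems by simp
    also have "\<dots> \<le> b * real (K + 1 - L) + b"
      using step.IH step.prems rec_sum[of K] by simp
    also have "\<dots> = b * real (Suc K + 1 - L)"
      unfolding * by (simp add: algebra_simps)
    finally show ?case .
  qed
  moreover have "u M > 0" using pos[of M] pos[of "M + 1"] by (simp add: u_def)
  ultimately show ?thesis using LM by fastforce
qed

text \<open>The window consists of the top \<open>\<lceil>x\<rceil> + 1\<close> indices, where the square roots are bounded below by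
  \<open>sqrt (j (N + 1 - j)) \<ge> (j / M) sqrt (M (N - M))\<close>.\<close>

lemma three_term_rec_not_all_pos:
  fixes h :: "nat \<Rightarrow> real" and b N x :: real
  assumes rec0: "h 1 = b * h 0"
    and rec: "\<And>k. real (k + 2) * h (k + 2) = b * h (k + 1) - (N - real k) * h k"
    and x: "x > 1" "x ^ 3 \<le> real M" and MN: "2 * real M \<le> N"
    and b: "b \<le> 2 * (x - 1) * sqrt (x * (N - x ^ 3))"
  shows "\<exists>k\<le>M + 1. h k \<le> 0"
proof (rule ccontr)
  assume "\<not> ?thesis"
  then have pos: "h k > 0" if "k \<le> M + 1" for k using that by force
  define c where "c = nat \<lceil>x\<rceil>"
  have c: "x \<le> real c" "real c < x + 1" using x unfolding c_def by linarith+
  have x3: "x \<le> x ^ 3" using x power_increasing[of 1 3 x] by simp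
  have M: "real M > 1" using x x3 by linarith
  have "x \<le> real M" using x x3 by linarith
  then have cM: "c \<le> M" unfolding c_def by linarith
  define S where "S = sqrt (real M * (N - real M))"
  have S: "S > 0" using M MN by (simp add: S_def)
  have "2 * (\<Sum>k = M - c..<M. real (k + 1) / real M * S)
      \<le> 2 * (\<Sum>k = M - c..<M. sqrt (real (k + 1) * (N - real k)))"
  proof (intro mult_left_mono sum_mono)
    fix k assume "k \<in> {M - c..<M}"
    then have k: "k + 1 \<le> M" by simp
    have "real (k + 1) / real M * S = sqrt ((real (k + 1) / real M)\<^sup>2 * (real M * (N - real M)))"
      unfolding S_def by (subst real_sqrt_mult) simp
    also have "\<dots> = sqrt ((real (k + 1))\<^sup>2 / real M * (N - real M))"
      using M by (simp add: power2_eq_square field_simps)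
    also have "\<dots> \<le> sqrt (real (k + 1) * (N - real k))"
    proof (intro real_sqrt_le_mono mult_mono)
      have "real (k + 1) * real (k + 1) \<le> real (k + 1) * real M"
        using k by (intro mult_left_mono) linarith+
      then show "(real (k + 1))\<^sup>2 / real M \<le> real (k + 1)"
        using M by (simp add: divide_le_eq power2_eq_square)
    qed (use k MN in linarith)+
    finally show "real (k + 1) / real M * S \<le> sqrt (real (k + 1) * (N - real k))" .
  qed simp
  also have "\<dots> < b * real (M + 1 - (M - c))"
    using three_term_rec_window_bound[OF rec0 rec pos, of M "M - c"] MN M by simp
  also have "\<dots> = b * (real c + 1)" using cM by simp
  also have "\<dots> \<le> 2 * (1 - 1 / x) * S * (real c + 1)"
  proof (rule mult_right_mono)
    have "sqrt (x * (N - x ^ 3)) = sqrt (x ^ 3 * (N - x ^ 3)) / x"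
    proof -
      have "x * (N - x ^ 3) = (x ^ 3 * (N - x ^ 3)) / x\<^sup>2"
        using x by (simp add: power2_eq_square power3_eq_cube field_simps)
      then show ?thesis using x by (simp add: real_sqrt_divide)
    qed
    also have "\<dots> \<le> S / x"
    proof -
      \<comment> \<open>This product is the increase of \<open>y * (N - y)\<close> from
        \<open>x ^ 3\<close> to \<open>M\<close>; both points are at most
        \<open>N / 2\<close>.\<close>
      have "(real M - x ^ 3) * (N - (real M + x ^ 3)) \<ge> 0"
        using x MN by (intro mult_nonneg_nonneg) linarith+
      then have "x ^ 3 * (N - x ^ 3) \<le> real M * (N - real M)" by (simp add: algebra_simps)
      then show ?thesis unfolding S_def using x by (intro divide_right_mono real_sqrt_le_mono) auto
    qed
    finally have "2 * (x - 1) * sqrt (x * (N - x ^ 3)) \<le> 2 * (x - 1) * (S / x)"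
      using x by (intro mult_left_mono) auto
    also have "\<dots> = 2 * (1 - 1 / x) * S" using x by (simp add: field_simps)
    finally show "b \<le> 2 * (1 - 1 / x) * S" using b by simp
  qed simp
  finally have "2 * (\<Sum>k = M - c..<M. real (k + 1) / real M * S) < 2 * (1 - 1 / x) * S * (real c + 1)" .
  moreover have "2 * (\<Sum>k = M - c..<M. real (k + 1) / real M * S)
      = S * (real c * (2 * real M - real c + 1) / real M)"
  proof -
    have "2 * (\<Sum>k = M - c..<M. real (k + 1)) = real c * (2 * real M - real c + 1)"
      using cM
    proof (induction c)
      case (Suc c)
      have "{M - Suc c..<M} = insert (M - Suc c) {M - c..<M}" using Suc.prems by auto
      then have "(\<Sum>k = M - Suc c..<M. real (k + 1)) = real (M - Suc c + 1) + (\<Sum>k = M - c..<M. real (k + 1))"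
        using Suc.prems by simp
      moreover have "real (M - Suc c + 1) = real M - real c" using Suc.prems by linarith
      ultimately show ?case using Suc by (simp add: algebra_simps)
    qed simp
    moreover have "(\<Sum>k = M - c..<M. real (k + 1) / real M * S)
        = (\<Sum>k = M - c..<M. real (k + 1)) * (S / real M)"
      unfolding sum_distrib_right by (rule sum.cong) simp_all
    ultimately show ?thesis by (simp only: mult.assoc[symmetric]) simp
  qed
  ultimately have "S * (real c * (2 * real M - real c + 1) / real M) < S * (2 * (1 - 1 / x) * (real c + 1))"
    by (simp add: mult_ac)
  then have "real c * (2 * real M - real c + 1) / real M < 2 * (1 - 1 / x) * (real c + 1)"
    by (simp only: mult_less_cancel_left_pos[OF S])
  then have "real c * (2 * real M - real c + 1) * x < 2 * (x - 1) * (real c + 1) * real M"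
    using x M by (simp add: field_simps)
  \<comment> \<open>The window length pays off here: \<open>c >= x\<close> makes the left side at
    least \<open>2 * M\<close>, while \<open>c < x + 1 < 2 * x\<close> keeps the right side at most
    \<open>2 * x ^ 3\<close>.\<close>
  then have "2 * real M * (real c + 1 - x) < real c * (real c - 1) * x" by (simp add: algebra_simps)
  moreover have "2 * real M * 1 \<le> 2 * real M * (real c + 1 - x)"
    using c by (intro mult_left_mono) auto
  moreover have "real c * (real c - 1) * x \<le> (2 * x) * x * x"
    using c x by (intro mult_mono) auto
  moreover have "(2 * x) * x * x = 2 * x ^ 3" by (simp add: power3_eq_cube)
  ultimately show False using x(2) by linarith
qed

section \<open>The bound on the degree of regularity\<close>

text \<open>A nonpositive coefficient at some \<open>k \<le> M + 1\<close> rules out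
  \<open>k\<close> below the degree of regularity; this index bound is the source of the summand
  1.\<close>

lemma degree_of_regularity_le:
  fixes f :: "nat \<Rightarrow> ('n::finite, 'k::field) mpoly" and x :: real
  defines "n \<equiv> CARD('n)"
  assumes f: "\<And>i. i \<in> {1..m} \<Longrightarrow> f i \<in> homog_part 2" and sr: "semi_regular m f"
    and x: "x > 1" "sextic m n x = 0" "x ^ 3 \<le> of_int \<lfloor>(2 * real m - real n) / 2\<rfloor>"
  shows "int (degree_of_regularity (ideal (f ` {1..m}))) \<le> 1 + \<lceil>x ^ 3\<rceil>"
proof -
  define h where "h k = real_of_int (semi_regular_coeff n m k)" for k
  define M where "M = nat \<lceil>x ^ 3\<rceil>"
  have n: "n \<ge> 1" by (simp add: n_def Suc_le_eq)
  have "x ^ 3 > 0" using x(1) by simp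
  then have M: "int M = \<lceil>x ^ 3\<rceil>" "x ^ 3 \<le> real M" unfolding M_def by linarith+
  have "\<exists>k\<le>M + 1. h k \<le> 0"
  proof (rule three_term_rec_not_all_pos[OF _ _ x(1) M(2)])
    show "h 1 = real n * h 0"
      unfolding h_def semi_regular_coeff_rec(2,3)[OF n] by simp
    show "real (k + 2) * h (k + 2) = real n * h (k + 1) - (2 * real m - real n - real k) * h k" for k
      using arg_cong[OF semi_regular_coeff_rec(1)[OF n, of k m], of real_of_int]
      unfolding h_def by simp
    \<comment> \<open>The floor is an integer, so rounding \<open>x ^ 3\<close> up does not exceed
      it.\<close>
    have "\<lceil>x ^ 3\<rceil> \<le> \<lfloor>(2 * real m - real n) / 2\<rfloor>" using x(3) by (simp add: ceiling_le_iff)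
    then have "real M \<le> (2 * real m - real n) / 2"
      unfolding le_floor_iff M(1)[symmetric] by simp
    then show "2 * real M \<le> 2 * real m - real n" by simp
    \<comment> \<open>The root equation is solved for \<open>n\<close>; the bound required of
      \<open>b\<close> holds with equality.\<close>
    have "real n = sqrt ((real n)\<^sup>2)" by simp
    also have "(real n)\<^sup>2 = (2 * (x - 1))\<^sup>2 * (x * (2 * real m - real n - x ^ 3))"
      using x(2) unfolding sextic_def power_mult_distrib by (simp add: mult_ac)
    also have "sqrt \<dots> = 2 * (x - 1) * sqrt (x * (2 * real m - real n - x ^ 3))"
      using x(1) by (subst real_sqrt_mult) simp
    finally show "real n \<le> 2 * (x - 1) * sqrt (x * (2 * real m - real n - x ^ 3))"
      by (rule eq_refl)
  qed
  then obtain k where k: "k \<le> M + 1" "semi_regular_coeff n m k \<le> 0" by (auto simp: h_def)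
  then have "degree_of_regularity (ideal (f ` {1..m})) \<le> k"
    using semi_regular_coeff_pos[OF f sr, of k] unfolding n_def by (meson not_le)
  then show ?thesis using k(1) M(1) by linarith
qed

theorem theorem7p1:
  fixes f :: "nat \<Rightarrow> ('n::finite, 'k::field) mpoly" and m n :: nat
  assumes "n = CARD('n)" and "m > n" and "n \<ge> 1"
    and "\<And>i. i \<in> {1..m} \<Longrightarrow> f i \<in> homog_part 2"
    and "finite_dim_quotient (ideal (f ` {1..m}))"
    and "semi_regular m f"
  shows "(\<exists>x'\<in>{1<..<root 3 (2 * real m - real n)}. \<forall>y\<in>{1<..}. sextic m n y \<le> sextic m n x') \<and>
    (\<forall>x'\<in>{1<..<root 3 (2 * real m - real n)}.
       (\<forall>y\<in>{1<..}. sextic m n y \<le> sextic m n x') \<and> sextic m n x' \<ge> 0 \<longrightarrow>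
       (\<exists>!x5. x5 \<in> {1<..x'} \<and> sextic m n x5 = 0) \<and>
       (\<forall>x5\<in>{1<..x'}. sextic m n x5 = 0 \<and> x5 ^ 3 \<le> of_int \<lfloor>(2 * real m - real n) / 2\<rfloor> \<longrightarrow>
          int (degree_of_regularity (ideal (f ` {1..m}))) \<le> 1 + \<lceil>x5 ^ 3\<rceil>))"
proof (intro conjI ballI impI)
  show "\<exists>x'\<in>{1<..<root 3 (2 * real m - real n)}. \<forall>y\<in>{1<..}. sextic m n y \<le> sextic m n x'"
    by (rule sextic_attains_max[OF assms(2,3)])
next
  fix x' assume "x' \<in> {1<..<root 3 (2 * real m - real n)}"
    and "(\<forall>y\<in>{1<..}. sextic m n y \<le> sextic m n x') \<and> sextic m n x' \<ge> 0"
  then show "\<exists>!x5. x5 \<in> {1<..x'} \<and> sextic m n x5 = 0"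
    using sextic_unique_root[OF assms(2,3)] by auto
next
  fix x' x5 assume "x5 \<in> {1<..x'}"
    "sextic m n x5 = 0 \<and> x5 ^ 3 \<le> of_int \<lfloor>(2 * real m - real n) / 2\<rfloor>"
  then show "int (degree_of_regularity (ideal (f ` {1..m}))) \<le> 1 + \<lceil>x5 ^ 3\<rceil>"
    using degree_of_regularity_le[OF assms(4,6)] assms(1) by auto
qed

end
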